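(* Let $q,a,b$ be complex numbers with $|q|<1$ and $|ab|<1$. Then $$\frac{(a^2q^3;q^4)_\infty\,(b^2q^3;q^4)_\infty}{(a^2q;q^4)_\infty\,(b^2q;q^4)_\infty} =\frac{1}{1-ab}\;{\atop +}\;\frac{(a-bq)(b-aq)}{(1-ab)(1+q^2)}\;{\atop +}\;\frac{(a-bq^3)(b-aq^3)}{(1-ab)(1+q^4)}\;{\atop +\cdots},$$ where the right-hand side is the infinite continued fraction with first partial numerator $1$, first partial denominator $1-ab$, and, for $n\ge1$, $(n+1)$-st partial numerator $(a-bq^{2n-1})(b-aq^{2n-1})$ and $(n+1)$-st partial denominator $(1-ab)(1+q^{2n})$.
   Context: For complex $x$ and $|p|<1$: $(x;p)_\infty=\prod_{j=0}^\infty(1-xp^j)$. Continued fractions: for sequences $(a_n)_{n\ge1}$, $(b_n)_{n\ge1}$ of complex numbers with all $a_n\ne0$ (here this means $(a-bq^{2n-1})(b-aq^{2n-1})\neq 0$ for all $n\ge1$), put $s_n(w)=a_n/(b_n+w)$ as maps of $\mathbb{C}\cup\{\infty\}$ and $S_n=s_1\circ\cdots\circ s_n$. The continued fraction $\frac{a_1}{b_1}{\atop +}\frac{a_2}{b_2}{\atop +\cdots}$ converges to the extended complex number $S$ if $S_n(0)\to S$; its value is then $S$. The assertion is that the continued fraction converges and has the stated value (in $\mathbb{C}\cup\{\infty\}$). *)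

theory Defs
  imports "HOL-Analysis.Analysis"
begin

text \<open>
  The base \<open>p\<close> is meant to satisfy \<open>norm p < 1\<close>. A vanishing factor makes \<open>prodinf\<close> equal to \<open>0\<close>,
  as it should, because \<open>has_prod\<close> allows finitely many zero factors.
\<close>

definition qpochhammer_inf :: "complex \<Rightarrow> complex \<Rightarrow> complex" where
  "qpochhammer_inf x p = (\<Prod>j. 1 - x * p ^ j)"

text \<open>
  The extended complex plane is the one-point compactification of the plane, with \<open>None\<close> as
  the point at infinity.
\<close>

type_synonym ecomplex = "complex option"

definition ecomplex_top :: "ecomplex topology" where
  "ecomplex_top = Alexandroff_compactification euclidean"

text \<open>
  The quotient as a point of the extended plane; only meaningful if numerator and denominator
  are not both \<open>0\<close>.
\<close>

definition equotient :: "complex \<Rightarrow> complex \<Rightarrow> ecomplex" where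
  "equotient z w = (if w = 0 then None else Some (z / w))"

text \<open>The map \<open>w \<mapsto> a / (b + w)\<close> of the extended plane, for \<open>a \<noteq> 0\<close>.\<close>

fun cf_map :: "complex \<Rightarrow> complex \<Rightarrow> ecomplex \<Rightarrow> ecomplex" where
  "cf_map a b None = Some 0"
| "cf_map a b (Some w) = equotient a (b + w)"

text \<open>
  \<open>cf_comp a b n\<close> is the composition of the maps with indices \<open>1, \<dots>, n\<close>; the entries \<open>a 0\<close>
  and \<open>b 0\<close> are not used.
\<close>

fun cf_comp :: "(nat \<Rightarrow> complex) \<Rightarrow> (nat \<Rightarrow> complex) \<Rightarrow> nat \<Rightarrow> ecomplex \<Rightarrow> ecomplex" where
  "cf_comp a b 0 = id"
| "cf_comp a b (Suc n) = cf_comp a b n \<circ> cf_map (a (Suc n)) (b (Suc n))"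

definition cf_converges_to :: "(nat \<Rightarrow> complex) \<Rightarrow> (nat \<Rightarrow> complex) \<Rightarrow> ecomplex \<Rightarrow> bool" where
  "cf_converges_to a b S \<longleftrightarrow>
     limitin ecomplex_top (\<lambda>n. cf_comp a b n (Some 0)) S sequentially"

end

theory Submission
  imports Defs
begin

text \<open>
  Write \<open>N n\<close> and \<open>D n\<close> for the canonical numerators and denominators of the convergents. Both
  solve the three-term recurrence
  \<open>y (n + 2) = (1 - ab) (1 + q^(2n+2)) y (n + 1) + (a - b q^(2n+1)) (b - a q^(2n+1)) y n\<close>,
  whose limiting characteristic equation \<open>\<lambda>^2 = (1 - ab) \<lambda> + ab\<close> has the roots \<open>1\<close> and \<open>-ab\<close>.
  As \<open>|ab| < 1\<close> and the perturbation is geometrically small, every solution converges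
  (\<open>cf_solution_LIMSEQ\<close>). So it suffices to find the limits \<open>N(a,b)\<close> and \<open>D(a,b)\<close>.

  The identification rests on a Bauer-Muir transformation, that is, on evaluating the convergents
  at \<open>w n = ab - q^(2n)\<close> instead of \<open>0\<close>. For this modification the auxiliary quantities
  \<open>\<lambda> n = (a - b q^(2n-1)) (b - a q^(2n-1)) - w (n-1) ((1 - ab) (1 + q^(2n)) + w n)\<close> factor as
  \<open>q^(2n-2) (1 - a^2 q) (1 - b^2 q)\<close>. Their constant quotient \<open>q^2\<close> turns the recurrence
  into the same recurrence with \<open>(a, b)\<close> replaced by \<open>(aq, bq)\<close> (\<open>bauer_muir\<close>). In the limit
  \<open>(1 + ab) N(a,b) = D(aq,bq)\<close> and
  \<open>(1 + ab) D(a,b) = (1 - a^2 q) (1 - b^2 q) N(aq,bq)\<close>.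

  Two such steps relate \<open>N(a,b)\<close> to \<open>N(aq^2,bq^2)\<close>. Iterating, and using the continuity of \<open>N\<close>
  at \<open>(0,0)\<close> (\<open>num_lim_continuous\<close>, by Tannery's theorem), one finds
  \<open>N(a,b) = (c / E) (a^2 q^3; q^4) (b^2 q^3; q^4)\<close> and, after one more step,
  \<open>D(a,b) = (c / E) (a^2 q; q^4) (b^2 q; q^4)\<close>, with the common nonzero factors \<open>c = N(0,0)\<close> and
  \<open>E = (-ab; q^4) (-ab q^2; q^4)\<close>. The two limits cannot both vanish, so \<open>N n / D n\<close> converges
  in the extended plane to their quotient, even where that is infinite.
\<close>

section \<open>Convergence in the extended plane\<close>

text \<open>
  When the denominators tend to \<open>0\<close>, the numerators stay away from \<open>0\<close>, so the quotients leave
  every compact set; individual quotients may already be infinite.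
\<close>

lemma limitin_equotient:
  assumes f: "f \<longlonglongrightarrow> x" and g: "g \<longlonglongrightarrow> y" and nz: "x \<noteq> 0 \<or> y \<noteq> 0"
  shows "limitin ecomplex_top (\<lambda>n. equotient (f n) (g n)) (equotient x y) sequentially"
  unfolding limitin_def
proof (intro conjI allI impI)
  show "equotient x y \<in> topspace ecomplex_top"
    by (auto simp: ecomplex_top_def equotient_def)
  fix U assume U: "openin ecomplex_top U \<and> equotient x y \<in> U"
  show "\<forall>\<^sub>F n in sequentially. equotient (f n) (g n) \<in> U"
  proof (cases "y = 0")
    case False
    define V where "V = Some -` U"
    have "open V"
      using U unfolding V_def ecomplex_top_def openin_Alexandroff_compactification
      by (auto simp: inj_vimage_image_eq vimage_def image_iff Compl_eq[symmetric] closed_def)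
    have "(\<lambda>n. f n / g n) \<longlonglongrightarrow> x / y"
      using f g False by (intro tendsto_divide) auto
    moreover have "x / y \<in> V"
      using U False by (simp add: V_def equotient_def)
    ultimately have "\<forall>\<^sub>F n in sequentially. f n / g n \<in> V"
      using \<open>open V\<close> by (auto dest: topological_tendstoD)
    moreover have "\<forall>\<^sub>F n in sequentially. g n \<noteq> 0"
      using tendsto_imp_eventually_ne[OF g False] .
    ultimately show ?thesis
      by eventually_elim (simp add: equotient_def V_def)
  next
    case True
    with nz have "x \<noteq> 0" by simp
    have "None \<in> U"
      using U True by (simp add: equotient_def)
    with U obtain C where C: "compact C" and UC: "U = insert None (Some ` (UNIV - C))"
      unfolding ecomplex_top_def openin_Alexandroff_compactification by auto
    from compact_imp_bounded[OF C] obtain B where B: "B > 0" "\<And>z. z \<in> C \<Longrightarrow> norm z \<le> B"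
      unfolding bounded_pos by blast
    have "(\<lambda>n. norm (f n) - B * norm (g n)) \<longlonglongrightarrow> norm x - B * norm y"
      by (intro tendsto_intros f g)
    hence "\<forall>\<^sub>F n in sequentially. norm (f n) - B * norm (g n) > 0"
      using True \<open>x \<noteq> 0\<close> by (intro order_tendstoD(1)[of _ "norm x - B * norm y"]) auto
    \<comment> \<open>Eventually \<open>norm (f n) > B * norm (g n)\<close>, so the quotient lies outside \<open>C\<close>.\<close>
    thus ?thesis
    proof eventually_elim
      case (elim n)
      show ?case
      proof (cases "g n = 0")
        case False
        have "f n / g n \<notin> C"
          using B(2)[of "f n / g n"] elim False
          by (auto simp: norm_divide divide_simps mult.commute)
        thus ?thesis using False by (simp add: UC equotient_def)
      qed (simp add: UC equotient_def)
    qed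
  qed
qed

text \<open>
  The classical matrix form of the composition. The index is shifted by one: \<open>A n\<close> and \<open>B n\<close> are
  the canonical numerator and denominator with index \<open>n - 1\<close>, so that \<open>A n / B n\<close> is the value at
  infinity. At the pole \<open>w = - b (Suc n)\<close> of the innermost map, numerator and denominator of the
  formula are the multiples \<open>a (Suc n) * A n\<close> and \<open>a (Suc n) * B n\<close>, and the nonzero factor cancels.
\<close>

lemma cf_comp_equotient:
  fixes A B a b :: "nat \<Rightarrow> complex"
  assumes A: "A 0 = 1" "A (Suc 0) = 0" "\<And>n. A (n + 2) = b (Suc n) * A (Suc n) + a (Suc n) * A n"
    and B: "B 0 = 0" "B (Suc 0) = 1" "\<And>n. B (n + 2) = b (Suc n) * B (Suc n) + a (Suc n) * B n"
    and a: "\<And>n. a (Suc n) \<noteq> 0"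
  shows "cf_comp a b n (Some w) = equotient (A (Suc n) + w * A n) (B (Suc n) + w * B n)"
    and "cf_comp a b n None = equotient (A n) (B n)"
proof (induction n arbitrary: w)
  case 0
  { case 1 show ?case using A B by (simp add: equotient_def) }
  { case 2 show ?case using A B by (simp add: equotient_def) }
next
  case (Suc n)
  have A2: "A (Suc (Suc n)) = b (Suc n) * A (Suc n) + a (Suc n) * A n"
    and B2: "B (Suc (Suc n)) = b (Suc n) * B (Suc n) + a (Suc n) * B n"
    using A(3)[of n] B(3)[of n] by simp_all
  have scale: "equotient (c * z) (c * z') = equotient z z'" if "c \<noteq> 0" for c z z'
    using that by (simp add: equotient_def)
  { case 1
    show ?case
    proof (cases "b (Suc n) + w = 0")
      case True
      hence "w = - b (Suc n)" by (simp add: add_eq_0_iff)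
      thus ?thesis
        using Suc(2) a[of n] by (simp add: equotient_def A2 B2)
    next
      case False
      let ?d = "b (Suc n) + w"
      have "cf_comp a b (Suc n) (Some w) =
              equotient (A (Suc n) + a (Suc n) / ?d * A n) (B (Suc n) + a (Suc n) / ?d * B n)"
        using Suc(1)[of "a (Suc n) / ?d"] False by (simp add: equotient_def)
      also have "\<dots> = equotient (?d * (A (Suc n) + a (Suc n) / ?d * A n))
                                (?d * (B (Suc n) + a (Suc n) / ?d * B n))"
        by (rule scale[OF False, symmetric])
      also have "\<dots> = equotient (A (Suc (Suc n)) + w * A (Suc n)) (B (Suc (Suc n)) + w * B (Suc n))"
      proof -
        have "?d * (x + c / ?d * z) = b (Suc n) * x + c * z + w * x" for x c z
          using False by (simp add: distrib_left) (simp add: algebra_simps)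
        thus ?thesis by (simp add: A2 B2)
      qed
      finally show ?thesis .
    qed }
  { case 2
    show ?case using Suc(1)[of 0] by simp }
qed

section \<open>Infinite products\<close>

lemma convergent_prod_qpochhammer:
  fixes x p :: complex
  assumes "norm p < 1"
  shows "convergent_prod (\<lambda>j. 1 - x * p ^ j)"
proof (rule abs_convergent_prod_imp_convergent_prod)
  have "summable (\<lambda>j. norm x * norm p ^ j)"
    using assms by (intro summable_mult summable_geometric) auto
  thus "abs_convergent_prod (\<lambda>j. 1 - x * p ^ j)"
    unfolding abs_convergent_prod_conv_summable by (simp add: norm_mult norm_power)
qed

lemma qpochhammer_inf_LIMSEQ:
  assumes "norm p < 1"
  shows "(\<lambda>n. \<Prod>j<n. 1 - x * p ^ j) \<longlonglongrightarrow> qpochhammer_inf x p"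
  using convergent_prod_LIMSEQ[OF convergent_prod_qpochhammer[OF assms, of x]]
    LIMSEQ_lessThan_iff_atMost[of "\<lambda>A. prod (\<lambda>j. 1 - x * p ^ j) A"]
  by (simp add: qpochhammer_inf_def)

lemma qpochhammer_inf_eq_0_iff:
  assumes "norm p < 1"
  shows "qpochhammer_inf x p = 0 \<longleftrightarrow> (\<exists>j. x * p ^ j = 1)"
proof -
  have "(\<lambda>j. 1 - x * p ^ j) has_prod qpochhammer_inf x p"
    using convergent_prod_has_prod[OF convergent_prod_qpochhammer[OF assms]]
    by (simp add: qpochhammer_inf_def)
  thus ?thesis
    by (subst has_prod_eq_0_iff) auto
qed

lemma qpochhammer_inf_nonzero:
  assumes "norm p < 1" "norm x < 1"
  shows "qpochhammer_inf x p \<noteq> 0"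
proof -
  have "x * p ^ j \<noteq> 1" for j
  proof -
    have "norm (x * p ^ j) \<le> norm x * 1"
      unfolding norm_mult norm_power using assms
      by (intro mult_left_mono power_le_one) auto
    thus ?thesis using assms(2) by auto
  qed
  thus ?thesis using assms by (simp add: qpochhammer_inf_eq_0_iff)
qed

lemma qpochhammer_inf_head:
  assumes "norm p < 1"
  shows "qpochhammer_inf x p = (1 - x) * qpochhammer_inf (x * p) p"
proof -
  have "(\<lambda>n. \<Prod>j<Suc n. 1 - x * p ^ j) \<longlonglongrightarrow> qpochhammer_inf x p"
    using qpochhammer_inf_LIMSEQ[OF assms] by (rule LIMSEQ_Suc)
  moreover have "(\<Prod>j<Suc n. 1 - x * p ^ j) = (1 - x) * (\<Prod>j<n. 1 - (x * p) * p ^ j)" for n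
    by (simp add: prod.lessThan_Suc_shift mult.assoc del: prod.lessThan_Suc)
  ultimately have "(\<lambda>n. (1 - x) * (\<Prod>j<n. 1 - (x * p) * p ^ j)) \<longlonglongrightarrow> qpochhammer_inf x p"
    by (simp only:)
  moreover have "(\<lambda>n. (1 - x) * (\<Prod>j<n. 1 - (x * p) * p ^ j)) \<longlonglongrightarrow> (1 - x) * qpochhammer_inf (x * p) p"
    by (intro tendsto_mult tendsto_const qpochhammer_inf_LIMSEQ assms)
  ultimately show ?thesis by (rule LIMSEQ_unique)
qed

section \<open>The three-term recurrence\<close>

text \<open>
  The starting values are kept general because one and the same transformation is applied to
  numerators and denominators. The canonical numerators have \<open>u = 0\<close>, \<open>v = 1\<close>
  and the canonical denominators \<open>u = 1\<close>, \<open>v = 1 - ab\<close>.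
\<close>

fun cf_solution :: "complex \<Rightarrow> complex \<Rightarrow> complex \<Rightarrow> complex \<Rightarrow> complex \<Rightarrow> nat \<Rightarrow> complex" where
  "cf_solution q a b u v 0 = u"
| "cf_solution q a b u v (Suc 0) = v"
| "cf_solution q a b u v (Suc (Suc n)) =
     (1 - a * b) * (1 + q ^ (2 * n + 2)) * cf_solution q a b u v (Suc n)
     + (a - b * q ^ (2 * n + 1)) * (b - a * q ^ (2 * n + 1)) * cf_solution q a b u v n"

lemma cf_solution_scale: "cf_solution q a b (c * u) (c * v) n = c * cf_solution q a b u v n"
  by (induction q a b u v n rule: cf_solution.induct) (simp_all add: algebra_simps)

text \<open>
  The Bauer-Muir transformation. The left-hand side is the numerator or denominator of the
  convergent evaluated at \<open>ab - q^(2n)\<close>. The constant term \<open>ab\<close> is the attracting fixed point of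
  the limiting map \<open>w \<mapsto> ab / (1 - ab + w)\<close> and the coefficient \<open>-1\<close> of \<open>q^(2n)\<close> is the
  repelling one; with these choices the transformed sequence satisfies a recurrence of the
  same shape.
\<close>

lemma bauer_muir:
  "cf_solution q a b u v (Suc n) + (a * b - q ^ (2 * n)) * cf_solution q a b u v n
   = cf_solution q (a * q) (b * q) (v + (a * b - 1) * u)
       ((1 - a * b * q\<^sup>2) * v + (a - b * q) * (b - a * q) * u) n"
proof (induction n rule: induct_nat_012)
  case 0
  show ?case by simp
next
  case 1
  show ?case by (simp add: algebra_simps power2_eq_square)
next
  case (ge2 n)
  \<comment> \<open>With \<open>X\<close> in place of the power, the claim is a polynomial identity in \<open>q\<close>, \<open>a\<close>, \<open>b\<close>, \<open>X\<close>
    and two consecutive solution values.\<close>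
  define X where "X = q ^ (2 * n)"
  have pow: "q ^ (2 * n + 1) = X * q" "q ^ (2 * n + 2) = X * q\<^sup>2"
    "q ^ (2 * Suc n) = X * q\<^sup>2" "q ^ (2 * Suc n + 1) = X * q ^ 3"
    "q ^ (2 * Suc n + 2) = X * q ^ 4" "q ^ (2 * Suc (Suc n)) = X * q ^ 4"
    "q ^ (2 * n) = X"
    by (simp_all add: X_def power_add power_mult eval_nat_numeral mult_ac)
  show ?case
    unfolding cf_solution.simps ge2[symmetric] pow by algebra
qed

text \<open>
  The limiting recurrence \<open>y (n + 2) = (1 - ab) y (n + 1) + ab y n\<close> leaves \<open>y (n + 1) + ab y n\<close>
  unchanged, so this combination moves only by a geometrically small amount, which is called the
  defect below.
\<close>

lemma cf_solution_step:
  "cf_solution q a b u v (Suc (Suc n)) + a * b * cf_solution q a b u v (Suc n)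
   = cf_solution q a b u v (Suc n) + a * b * cf_solution q a b u v n
     + ((1 - a * b) * q ^ (2 * n + 2) * cf_solution q a b u v (Suc n)
        + (a * b * q ^ (4 * n + 2) - (a\<^sup>2 + b\<^sup>2) * q ^ (2 * n + 1)) * cf_solution q a b u v n)"
proof -
  have "q ^ (4 * n + 2) = (q ^ (2 * n + 1))\<^sup>2"
    by (subst power_mult[symmetric]) simp
  thus ?thesis
    by (simp only: cf_solution.simps) (simp add: algebra_simps power2_eq_square)
qed

definition cf_defect :: "complex \<Rightarrow> complex \<Rightarrow> complex \<Rightarrow> complex \<Rightarrow> complex \<Rightarrow> nat \<Rightarrow> complex" where
  "cf_defect q a b u v n =
     (1 - a * b) * q ^ (2 * n + 2) * cf_solution q a b u v (Suc n)
     + (a * b * q ^ (4 * n + 2) - (a\<^sup>2 + b\<^sup>2) * q ^ (2 * n + 1)) * cf_solution q a b u v n"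

lemma norm_cf_defect_le:
  assumes q: "norm q < 1" and ab: "norm (a * b) \<le> 1" and "norm a \<le> \<alpha>" "norm b \<le> \<beta>"
    and M: "norm (cf_solution q a b u v n) \<le> M" "norm (cf_solution q a b u v (Suc n)) \<le> M"
  shows "norm (cf_defect q a b u v n) \<le> (3 + \<alpha>\<^sup>2 + \<beta>\<^sup>2) * norm q ^ n * M"
proof -
  let ?r = "norm q ^ n"
  have pw: "norm (q ^ k) \<le> ?r" if "k \<ge> n" for k
    using that q unfolding norm_power by (intro power_decreasing) auto
  have "norm (1 - a * b) \<le> 2"
    using norm_triangle_ineq4[of 1 "a * b"] ab by simp
  hence 1: "norm ((1 - a * b) * q ^ (2 * n + 2)) \<le> 2 * ?r"
    unfolding norm_mult[of "1 - a * b"] by (intro mult_mono pw) auto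
  have 2: "norm (a * b * q ^ (4 * n + 2)) \<le> 1 * ?r"
    unfolding norm_mult[of "a * b"] using ab by (intro mult_mono pw) auto
  have "norm (a\<^sup>2 + b\<^sup>2) \<le> \<alpha>\<^sup>2 + \<beta>\<^sup>2"
    using assms(3,4)
    by (intro order_trans[OF norm_triangle_ineq] add_mono) (auto simp: norm_power intro!: power_mono)
  hence 3: "norm ((a\<^sup>2 + b\<^sup>2) * q ^ (2 * n + 1)) \<le> (\<alpha>\<^sup>2 + \<beta>\<^sup>2) * ?r"
    unfolding norm_mult[of "a\<^sup>2 + b\<^sup>2"] by (intro mult_mono pw) auto
  have 4: "norm (a * b * q ^ (4 * n + 2) - (a\<^sup>2 + b\<^sup>2) * q ^ (2 * n + 1)) \<le> (1 + \<alpha>\<^sup>2 + \<beta>\<^sup>2) * ?r"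
    using norm_triangle_ineq4[of "a * b * q ^ (4 * n + 2)" "(a\<^sup>2 + b\<^sup>2) * q ^ (2 * n + 1)"] 2 3
    by (simp add: algebra_simps)
  have "norm (cf_defect q a b u v n) \<le> (2 * ?r) * M + ((1 + \<alpha>\<^sup>2 + \<beta>\<^sup>2) * ?r) * M"
    unfolding cf_defect_def
    by (rule order_trans[OF norm_triangle_ineq], unfold norm_mult[of _ "cf_solution q a b u v k" for k])
       (intro add_mono mult_mono 1 4 M; simp add: add_nonneg_nonneg)
  thus ?thesis by (simp add: algebra_simps)
qed

text \<open>
  A discrete Gronwall estimate. The bound depends on \<open>a\<close> and \<open>b\<close> only through \<open>\<alpha>\<close>, \<open>\<beta>\<close> and \<open>\<rho>\<close>;
  this uniformity is what makes dominated convergence along a sequence of parameters possible.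
\<close>

lemma norm_cf_solution_le:
  assumes q: "norm q < 1" and ab: "norm (a * b) \<le> \<rho>" "\<rho> < 1" and "norm a \<le> \<alpha>" "norm b \<le> \<beta>"
    and K: "norm u \<le> K" "norm (v + a * b * u) \<le> K"
  shows "norm (cf_solution q a b u v n)
           \<le> K / (1 - \<rho>) * exp ((3 + \<alpha>\<^sup>2 + \<beta>\<^sup>2) / (1 - \<rho>) * (1 / (1 - norm q)))"
proof -
  define y where "y = cf_solution q a b u v"
  define C where "C = (3 + \<alpha>\<^sup>2 + \<beta>\<^sup>2) / (1 - \<rho>)"
  define G where "G n = exp (C * (\<Sum>k<n. norm q ^ k))" for n
  have \<rho>: "0 \<le> \<rho>" using ab norm_ge_zero order_trans by blast
  have C: "C \<ge> 0" unfolding C_def using ab \<rho> by (intro divide_nonneg_pos) (auto intro!: add_nonneg_nonneg)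
  have K0: "K \<ge> 0" using K(1) norm_ge_zero order_trans by blast
  have mono: "G m \<le> G n" if "m \<le> n" for m n
    unfolding G_def using that C
    by (auto intro!: mult_left_mono sum_mono2)
  have Gs: "G n * (1 + C * norm q ^ n) \<le> G (Suc n)" for n
  proof -
    have "G (Suc n) = G n * exp (C * norm q ^ n)"
      by (simp add: G_def distrib_left exp_add)
    moreover have "1 + C * norm q ^ n \<le> exp (C * norm q ^ n)" "G n \<ge> 0"
      by (simp_all add: G_def)
    ultimately show ?thesis by (simp add: mult_left_mono)
  qed
  \<comment> \<open>The combination \<open>y (n + 1) + ab y n\<close> grows at most by the factor \<open>1 + C |q|^n\<close> per step; solving
    for \<open>y (n + 1)\<close> costs the geometric series \<open>1 + \<rho> + \<rho>^2 + \<dots> = 1 / (1 - \<rho>)\<close>.\<close>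
  have main: "norm (y n) \<le> K / (1 - \<rho>) * G n \<and> norm (y (Suc n)) \<le> K / (1 - \<rho>) * G n
              \<and> norm (y (Suc n) + a * b * y n) \<le> K * G n" for n
  proof (induction n)
    case 0
    have "K * (1 - \<rho>) \<le> K" using K0 \<rho> by (simp add: mult_left_le)
    hence u: "norm u \<le> K / (1 - \<rho>)"
      using K(1) ab by (simp add: pos_le_divide_eq) (smt (verit) K0 \<rho> mult_right_mono)
    have "norm v \<le> norm (v + a * b * u) + norm (a * b) * norm u"
      using norm_triangle_ineq4[of "v + a * b * u" "a * b * u"] by (simp add: norm_mult)
    also have "\<dots> \<le> K + \<rho> * (K / (1 - \<rho>))"
      using K ab u \<rho> by (intro add_mono mult_mono) auto
    also have "\<dots> = K / (1 - \<rho>)" using ab by (simp add: field_simps)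
    finally show ?case using u K by (simp add: y_def G_def)
  next
    case (Suc n)
    have "norm (cf_defect q a b u v n) \<le> (3 + \<alpha>\<^sup>2 + \<beta>\<^sup>2) * norm q ^ n * (K / (1 - \<rho>) * G n)"
      using Suc ab assms(4,5) q by (intro norm_cf_defect_le) (auto simp: y_def)
    also have "\<dots> = K * G n * (C * norm q ^ n)" by (simp add: C_def)
    finally have d: "norm (cf_defect q a b u v n) \<le> K * G n * (C * norm q ^ n)" .
    have "norm (y (Suc (Suc n)) + a * b * y (Suc n)) \<le> norm (y (Suc n) + a * b * y n) + norm (cf_defect q a b u v n)"
      unfolding y_def cf_solution_step cf_defect_def[symmetric] by (rule norm_triangle_ineq)
    also have "\<dots> \<le> K * G n + K * G n * (C * norm q ^ n)"
      using Suc d by (intro add_mono) auto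
    also have "\<dots> = K * (G n * (1 + C * norm q ^ n))" by (simp add: algebra_simps)
    also have "\<dots> \<le> K * G (Suc n)" by (intro mult_left_mono Gs K0)
    finally have R: "norm (y (Suc (Suc n)) + a * b * y (Suc n)) \<le> K * G (Suc n)" .
    have "K / (1 - \<rho>) * G n \<le> K / (1 - \<rho>) * G (Suc n)"
      using K0 ab by (intro mult_left_mono mono) auto
    with Suc have y1: "norm (y (Suc n)) \<le> K / (1 - \<rho>) * G (Suc n)" by linarith
    have "norm (y (Suc (Suc n))) \<le> norm (y (Suc (Suc n)) + a * b * y (Suc n)) + norm (a * b) * norm (y (Suc n))"
      using norm_triangle_ineq4[of "y (Suc (Suc n)) + a * b * y (Suc n)" "a * b * y (Suc n)"]
      by (simp add: norm_mult)
    also have "\<dots> \<le> K * G (Suc n) + \<rho> * (K / (1 - \<rho>) * G (Suc n))"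
      using R y1 ab \<rho> by (intro add_mono mult_mono) auto
    also have "\<dots> = K / (1 - \<rho>) * G (Suc n)" using ab by (simp add: field_simps)
    finally show ?case using R y1 by blast
  qed
  have "(\<Sum>k<n. norm q ^ k) \<le> (\<Sum>k. norm q ^ k)"
    using q by (intro sum_le_suminf summable_geometric) auto
  also have "\<dots> = 1 / (1 - norm q)" using q by (intro suminf_geometric) auto
  finally have "G n \<le> exp (C * (1 / (1 - norm q)))"
    unfolding G_def using C by (simp add: mult_left_mono del: times_divide_eq_right)
  hence "K / (1 - \<rho>) * G n \<le> K / (1 - \<rho>) * exp (C * (1 / (1 - norm q)))"
    using K0 ab by (intro mult_left_mono) auto
  with main[of n] show ?thesis unfolding y_def C_def by linarith
qed

lemma one_plus_nonzero: "norm z < 1 \<Longrightarrow> 1 + z \<noteq> (0::complex)"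
  by (metis add_eq_0_iff norm_minus_cancel norm_one order_less_irrefl)

text \<open>
  Subtracting the fixed point \<open>L / (1 + s)\<close> reduces to the case \<open>L = 0\<close>, where an initial error
  decays like \<open>|s|^k\<close> and the later small errors add up to a geometric series.
\<close>

lemma LIMSEQ_contracting_recurrence:
  fixes y :: "nat \<Rightarrow> complex"
  assumes s: "norm s < 1" and lim: "(\<lambda>n. y (Suc n) + s * y n) \<longlonglongrightarrow> L"
  shows "y \<longlonglongrightarrow> L / (1 + s)"
proof -
  have s1: "1 + s \<noteq> 0"
    using s by (rule one_plus_nonzero)
  define x where "x n = y n - L / (1 + s)" for n
  have "L = (1 + s) * (L / (1 + s))"
    using s1 by simp
  hence "x (Suc n) + s * x n = (y (Suc n) + s * y n) - L" for n
    unfolding x_def by algebra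
  hence x0: "(\<lambda>n. x (Suc n) + s * x n) \<longlonglongrightarrow> 0"
    using lim by (simp add: LIM_zero_iff)
  have "x \<longlonglongrightarrow> 0"
  proof (rule LIMSEQ_I)
    fix \<epsilon> :: real assume \<epsilon>: "\<epsilon> > 0"
    define \<delta> where "\<delta> = \<epsilon> / 2 * (1 - norm s)"
    have "\<delta> > 0" using \<epsilon> s by (simp add: \<delta>_def)
    then obtain N where N: "\<And>n. n \<ge> N \<Longrightarrow> norm (x (Suc n) + s * x n) < \<delta>"
      using LIMSEQ_D[OF x0, of \<delta>] by auto
    have decay: "norm (x (N + k)) \<le> \<epsilon> / 2 + norm s ^ k * norm (x N)" for k
    proof (induction k)
      case 0
      show ?case using \<epsilon> by simp
    next
      case (Suc k)
      have "norm (x (N + Suc k)) \<le> norm (x (Suc (N + k)) + s * x (N + k)) + norm s * norm (x (N + k))"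
        using norm_triangle_ineq4[of "x (Suc (N + k)) + s * x (N + k)" "s * x (N + k)"]
        by (simp add: norm_mult)
      also have "\<dots> \<le> \<delta> + norm s * (\<epsilon> / 2 + norm s ^ k * norm (x N))"
        using N[of "N + k"] Suc by (intro add_mono mult_left_mono) auto
      also have "\<dots> = \<epsilon> / 2 + norm s ^ Suc k * norm (x N)"
        by (simp add: \<delta>_def field_simps)
      finally show ?case .
    qed
    have "(\<lambda>k. norm s ^ k * norm (x N)) \<longlonglongrightarrow> 0 * norm (x N)"
      using s by (intro tendsto_mult LIMSEQ_power_zero tendsto_const) auto
    hence "\<forall>\<^sub>F k in sequentially. norm s ^ k * norm (x N) < \<epsilon> / 2"
      using \<epsilon> by (intro order_tendstoD(2)[where y = "0 * norm (x N)"]) auto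
    then obtain k0 where k0: "\<And>k. k \<ge> k0 \<Longrightarrow> norm s ^ k * norm (x N) < \<epsilon> / 2"
      by (auto simp: eventually_sequentially)
    show "\<exists>n0. \<forall>n\<ge>n0. norm (x n - 0) < \<epsilon>"
    proof (intro exI allI impI)
      fix n assume n: "n \<ge> N + k0"
      then obtain k where k: "n = N + k" "k \<ge> k0"
        by (metis add_le_cancel_left le_add1 le_iff_add order_trans)
      show "norm (x n - 0) < \<epsilon>"
        using decay[of k] k0[of k] k by simp
    qed
  qed
  thus ?thesis by (simp add: x_def[abs_def] LIM_zero_iff)
qed

text \<open>
  Writing the limit as an infinite series of defects is what later allows passing to the limit
  in the parameters.
\<close>

lemma cf_solution_LIMSEQ:
  assumes q: "norm q < 1" and ab: "norm (a * b) < 1"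
  shows "cf_solution q a b u v \<longlonglongrightarrow> (v + a * b * u + (\<Sum>n. cf_defect q a b u v n)) / (1 + a * b)"
proof -
  let ?y = "cf_solution q a b u v" and ?d = "cf_defect q a b u v"
  obtain M where M: "\<And>n. norm (?y n) \<le> M"
    using norm_cf_solution_le[OF q order_refl ab order_refl order_refl max.cobounded1 max.cobounded2]
    by blast
  have "summable (\<lambda>n. (3 + (norm a)\<^sup>2 + (norm b)\<^sup>2) * norm q ^ n * M)"
    using q by (intro summable_mult summable_mult2 summable_geometric) auto
  hence "summable ?d"
    using q ab M by (rule_tac summable_comparison_test'[where N = 0])
      (auto intro!: norm_cf_defect_le)
  hence "(\<lambda>n. \<Sum>k<n. ?d k) \<longlonglongrightarrow> (\<Sum>n. ?d n)"
    by (rule summable_LIMSEQ)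
  hence "(\<lambda>n. v + a * b * u + (\<Sum>k<n. ?d k)) \<longlonglongrightarrow> v + a * b * u + (\<Sum>n. ?d n)"
    by (intro tendsto_intros)
  moreover have "?y (Suc n) + a * b * ?y n = v + a * b * u + (\<Sum>k<n. ?d k)" for n
  proof (induction n)
    case (Suc n)
    thus ?case
      by (simp only: cf_solution_step cf_defect_def[symmetric] sum.lessThan_Suc) (simp add: cf_defect_def)
  qed simp
  ultimately have "(\<lambda>n. ?y (Suc n) + a * b * ?y n) \<longlonglongrightarrow> v + a * b * u + (\<Sum>n. ?d n)"
    by (simp only:)
  thus ?thesis by (rule LIMSEQ_contracting_recurrence[OF ab])
qed

section \<open>The limits of the numerators and denominators\<close>

definition num_lim :: "complex \<Rightarrow> complex \<Rightarrow> complex \<Rightarrow> complex" where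
  "num_lim q a b = lim (cf_solution q a b 0 1)"

definition den_lim :: "complex \<Rightarrow> complex \<Rightarrow> complex \<Rightarrow> complex" where
  "den_lim q a b = lim (cf_solution q a b 1 (1 - a * b))"

lemma num_lim_LIMSEQ:
  assumes "norm q < 1" "norm (a * b) < 1"
  shows "cf_solution q a b 0 1 \<longlonglongrightarrow> num_lim q a b"
  unfolding num_lim_def
  by (rule convergent_LIMSEQ_iff[THEN iffD1, OF convergentI, OF cf_solution_LIMSEQ[OF assms]])

lemma den_lim_LIMSEQ:
  assumes "norm q < 1" "norm (a * b) < 1"
  shows "cf_solution q a b 1 (1 - a * b) \<longlonglongrightarrow> den_lim q a b"
  unfolding den_lim_def
  by (rule convergent_LIMSEQ_iff[THEN iffD1, OF convergentI, OF cf_solution_LIMSEQ[OF assms]])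

lemma norm_mult_shrink:
  fixes a b c d :: complex
  assumes "norm (a * b) < 1" "norm c \<le> 1" "norm d \<le> 1"
  shows "norm ((a * c) * (b * d)) < 1"
proof -
  have "norm ((a * c) * (b * d)) = norm (a * b) * (norm c * norm d)"
    by (simp add: norm_mult)
  also have "\<dots> \<le> norm (a * b) * 1"
    using assms by (intro mult_left_mono mult_le_one) auto
  finally show ?thesis using assms by simp
qed

text \<open>
  The modified sequences on the left of the Bauer-Muir identity converge along with the original
  ones.
\<close>

lemma LIMSEQ_bauer_muir:
  assumes "norm q < 1" "y \<longlonglongrightarrow> L"
  shows "(\<lambda>n. y (Suc n) + (s - q ^ (2 * n)) * y n) \<longlonglongrightarrow> (1 + s) * (L :: complex)"
proof -
  have "norm (q\<^sup>2) < 1"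
    using assms(1) by (simp add: norm_power abs_square_less_1)
  hence "(\<lambda>n. y (Suc n) + (s - q ^ (2 * n)) * y n) \<longlonglongrightarrow> L + (s - 0) * L"
    unfolding power_mult by (intro tendsto_intros LIMSEQ_Suc[OF assms(2)] assms(2))
  thus ?thesis by (simp add: algebra_simps)
qed

text \<open>
  For the numerators, the transformed starting values \<open>1\<close> and \<open>1 - ab q^2\<close> are exactly those of
  the denominators for \<open>(aq, bq)\<close>.
\<close>

lemma num_lim_shift:
  assumes q: "norm q < 1" and ab: "norm (a * b) < 1"
  shows "(1 + a * b) * num_lim q a b = den_lim q (a * q) (b * q)"
proof (rule LIMSEQ_unique)
  show "(\<lambda>n. cf_solution q a b 0 1 (Suc n) + (a * b - q ^ (2 * n)) * cf_solution q a b 0 1 n)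
          \<longlonglongrightarrow> (1 + a * b) * num_lim q a b"
    by (rule LIMSEQ_bauer_muir[OF q num_lim_LIMSEQ[OF assms]])
  have "cf_solution q (a * q) (b * q) 1 (1 - (a * q) * (b * q)) \<longlonglongrightarrow> den_lim q (a * q) (b * q)"
    using q by (intro den_lim_LIMSEQ norm_mult_shrink ab) auto
  thus "(\<lambda>n. cf_solution q a b 0 1 (Suc n) + (a * b - q ^ (2 * n)) * cf_solution q a b 0 1 n)
          \<longlonglongrightarrow> den_lim q (a * q) (b * q)"
    unfolding bauer_muir by (simp add: power2_eq_square mult_ac)
qed

text \<open>
  For the denominators, the transformed starting values are \<open>0\<close> and \<open>(1 - a^2 q) (1 - b^2 q)\<close>,
  a multiple of those of the numerators for \<open>(aq, bq)\<close>.
\<close>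

lemma den_lim_shift:
  assumes q: "norm q < 1" and ab: "norm (a * b) < 1"
  shows "(1 + a * b) * den_lim q a b = (1 - a\<^sup>2 * q) * (1 - b\<^sup>2 * q) * num_lim q (a * q) (b * q)"
proof (rule LIMSEQ_unique)
  let ?y = "cf_solution q a b 1 (1 - a * b)"
  let ?c = "(1 - a\<^sup>2 * q) * (1 - b\<^sup>2 * q)"
  show "(\<lambda>n. ?y (Suc n) + (a * b - q ^ (2 * n)) * ?y n) \<longlonglongrightarrow> (1 + a * b) * den_lim q a b"
    by (rule LIMSEQ_bauer_muir[OF q den_lim_LIMSEQ[OF assms]])
  have "(\<lambda>n. ?c * cf_solution q (a * q) (b * q) 0 1 n) \<longlonglongrightarrow> ?c * num_lim q (a * q) (b * q)"
    using q by (intro tendsto_mult tendsto_const num_lim_LIMSEQ norm_mult_shrink ab) auto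
  moreover have "(1 - a * b * q\<^sup>2) * (1 - a * b) + (a - b * q) * (b - a * q) * 1 = ?c * 1"
    "1 - a * b + (a * b - 1) * 1 = ?c * 0"
    by algebra+
  ultimately show "(\<lambda>n. ?y (Suc n) + (a * b - q ^ (2 * n)) * ?y n) \<longlonglongrightarrow> ?c * num_lim q (a * q) (b * q)"
    unfolding bauer_muir by (simp only: cf_solution_scale)
qed

lemma num_lim_shift2:
  assumes q: "norm q < 1" and ab: "norm (a * b) < 1"
  shows "(1 + a * b) * (1 + a * b * q\<^sup>2) * num_lim q a b
           = (1 - a\<^sup>2 * q ^ 3) * (1 - b\<^sup>2 * q ^ 3) * num_lim q (a * q\<^sup>2) (b * q\<^sup>2)"
proof -
  have ab': "norm ((a * q) * (b * q)) < 1"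
    using q by (intro norm_mult_shrink ab) auto
  have "(1 + a * b) * (1 + a * b * q\<^sup>2) * num_lim q a b
          = (1 + (a * q) * (b * q)) * den_lim q (a * q) (b * q)"
    unfolding num_lim_shift[OF assms, symmetric] by (simp add: power2_eq_square algebra_simps)
  also have "\<dots> = (1 - (a * q)\<^sup>2 * q) * (1 - (b * q)\<^sup>2 * q) * num_lim q (a * q * q) (b * q * q)"
    by (rule den_lim_shift[OF q ab'])
  also have "\<dots> = (1 - a\<^sup>2 * q ^ 3) * (1 - b\<^sup>2 * q ^ 3) * num_lim q (a * q\<^sup>2) (b * q\<^sup>2)"
    by (simp add: power2_eq_square power3_eq_cube mult_ac)
  finally show ?thesis .
qed

lemma num_lim_iterate:
  assumes q: "norm q < 1" and ab: "norm (a * b) < 1"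
  shows "(\<Prod>k<m. 1 - (- a * b) * (q ^ 4) ^ k) * (\<Prod>k<m. 1 - (- a * b * q\<^sup>2) * (q ^ 4) ^ k) * num_lim q a b
       = (\<Prod>k<m. 1 - (a\<^sup>2 * q ^ 3) * (q ^ 4) ^ k) * (\<Prod>k<m. 1 - (b\<^sup>2 * q ^ 3) * (q ^ 4) ^ k)
           * num_lim q (a * q ^ (2 * m)) (b * q ^ (2 * m))"
proof (induction m)
  case (Suc m)
  define X where "X = q ^ (2 * m)"
  have X4: "(q ^ 4) ^ m = X\<^sup>2"
    by (simp add: X_def flip: power_mult)
  have XS: "q ^ (2 * Suc m) = X * q\<^sup>2" by (simp add: X_def power_add power2_eq_square)
  have "norm ((a * X) * (b * X)) < 1"
    using q by (intro norm_mult_shrink ab) (auto simp: X_def norm_power intro!: power_le_one)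
  from num_lim_shift2[OF q this]
  have "(1 - - a * b * X\<^sup>2) * (1 - - a * b * q\<^sup>2 * X\<^sup>2) * num_lim q (a * X) (b * X)
      = (1 - a\<^sup>2 * q ^ 3 * X\<^sup>2) * (1 - b\<^sup>2 * q ^ 3 * X\<^sup>2) * num_lim q (a * (X * q\<^sup>2)) (b * (X * q\<^sup>2))"
    by (simp add: power_mult_distrib power2_eq_square mult_ac)
  with Suc show ?case
    unfolding prod.lessThan_Suc XS X4 X_def[symmetric] by algebra
qed simp

text \<open>
  Each defect is a polynomial in the parameters and the uniform bound on the solutions gives a
  geometric majorant, so Tannery's theorem applies to the series that represents the limit.
\<close>

lemma num_lim_continuous:
  assumes q: "norm q < 1" and A: "A \<longlonglongrightarrow> a" and B: "B \<longlonglongrightarrow> b"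
    and bound: "\<And>m. norm (A m) \<le> \<alpha>" "\<And>m. norm (B m) \<le> \<beta>" "\<And>m. norm (A m * B m) \<le> \<rho>" and \<rho>: "\<rho> < 1"
  shows "(\<lambda>m. num_lim q (A m) (B m)) \<longlonglongrightarrow> num_lim q a b"
proof -
  have ab: "norm (a * b) \<le> \<rho>"
    using bound(3) by (intro Lim_norm_ubound[OF _ tendsto_mult[OF A B]]) auto
  have num: "num_lim q a' b' = (1 + (\<Sum>n. cf_defect q a' b' 0 1 n)) / (1 + a' * b')"
    if "norm (a' * b') \<le> \<rho>" for a' b'
  proof -
    have "norm (a' * b') < 1" using that \<rho> by linarith
    from LIMSEQ_unique[OF num_lim_LIMSEQ[OF q this] cf_solution_LIMSEQ[OF q this]]
    show ?thesis by simp
  qed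
  have sol: "(\<lambda>m. cf_solution q (A m) (B m) 0 1 n) \<longlonglongrightarrow> cf_solution q a b 0 1 n" for n
    by (induction n rule: induct_nat_012) (auto intro!: tendsto_intros A B)
  have defect: "(\<lambda>m. cf_defect q (A m) (B m) 0 1 n) \<longlonglongrightarrow> cf_defect q a b 0 1 n" for n
    unfolding cf_defect_def by (intro tendsto_intros A B sol)
  obtain M where M: "\<And>m n. norm (cf_solution q (A m) (B m) 0 1 n) \<le> M"
    using norm_cf_solution_le[OF q bound(3) \<rho> bound(1,2), of 0 1 1] by auto
  have "(\<lambda>m. \<Sum>n. cf_defect q (A m) (B m) 0 1 n) \<longlonglongrightarrow> (\<Sum>n. cf_defect q a b 0 1 n)"
  proof (rule tannerys_theorem[THEN conjunct2, THEN conjunct2])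
    show "summable (\<lambda>n. (3 + \<alpha>\<^sup>2 + \<beta>\<^sup>2) * norm q ^ n * M)"
      using q by (intro summable_mult summable_mult2 summable_geometric) auto
    have "norm (A m * B m) \<le> 1" for m using bound(3)[of m] \<rho> by linarith
    thus "\<forall>\<^sub>F (n, m) in sequentially \<times>\<^sub>F sequentially.
            norm (cf_defect q (A m) (B m) 0 1 n) \<le> (3 + \<alpha>\<^sup>2 + \<beta>\<^sup>2) * norm q ^ n * M"
      using q bound M by (intro always_eventually) (auto intro!: norm_cf_defect_le)
  qed (use defect in auto)
  hence "(\<lambda>m. (1 + (\<Sum>n. cf_defect q (A m) (B m) 0 1 n)) / (1 + A m * B m))
           \<longlonglongrightarrow> (1 + (\<Sum>n. cf_defect q a b 0 1 n)) / (1 + a * b)"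
    using ab \<rho> by (intro tendsto_intros A B one_plus_nonzero) auto
  thus ?thesis using num ab bound(3) by simp
qed

text \<open>
  For \<open>a = b = 0\<close> the partial numerators vanish and the recurrence is a plain product.
\<close>

lemma num_lim_0_0:
  assumes "norm q < 1"
  shows "num_lim q 0 0 = qpochhammer_inf (- q\<^sup>2) (q\<^sup>2)"
proof (rule LIMSEQ_unique)
  have "cf_solution q 0 0 0 1 (Suc n) = (\<Prod>j<n. 1 - (- q\<^sup>2) * (q\<^sup>2) ^ j)" for n
  proof (induction n)
    case (Suc n)
    have "q ^ (2 * n + 2) = q\<^sup>2 * (q\<^sup>2) ^ n"
      unfolding power_add power_mult by (rule mult.commute)
    hence "cf_solution q 0 0 0 1 (Suc (Suc n))
        = (1 - (- q\<^sup>2) * (q\<^sup>2) ^ n) * cf_solution q 0 0 0 1 (Suc n)"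
      unfolding cf_solution.simps by simp
    with Suc show ?case by (simp only: prod.lessThan_Suc mult.commute)
  qed simp
  moreover have "norm (q\<^sup>2) < 1"
    using assms by (simp add: norm_power abs_square_less_1)
  ultimately show "(\<lambda>n. cf_solution q 0 0 0 1 (Suc n)) \<longlonglongrightarrow> qpochhammer_inf (- q\<^sup>2) (q\<^sup>2)"
    using qpochhammer_inf_LIMSEQ[of "q\<^sup>2" "- q\<^sup>2"] by simp
  show "(\<lambda>n. cf_solution q 0 0 0 1 (Suc n)) \<longlonglongrightarrow> num_lim q 0 0"
    by (rule LIMSEQ_Suc, rule num_lim_LIMSEQ[OF assms]) simp
qed

lemma num_lim_product:
  assumes q: "norm q < 1" and ab: "norm (a * b) < 1"
  shows "qpochhammer_inf (- a * b) (q ^ 4) * qpochhammer_inf (- a * b * q\<^sup>2) (q ^ 4) * num_lim q a b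
       = qpochhammer_inf (a\<^sup>2 * q ^ 3) (q ^ 4) * qpochhammer_inf (b\<^sup>2 * q ^ 3) (q ^ 4) * num_lim q 0 0"
proof (rule LIMSEQ_unique)
  have q4: "norm (q ^ 4) < 1"
    using q by (simp add: norm_power power_less_one_iff)
  let ?P = "\<lambda>x m. \<Prod>k<m. 1 - x * (q ^ 4) ^ k"
  show "(\<lambda>m. ?P (- a * b) m * ?P (- a * b * q\<^sup>2) m * num_lim q a b) \<longlonglongrightarrow>
          qpochhammer_inf (- a * b) (q ^ 4) * qpochhammer_inf (- a * b * q\<^sup>2) (q ^ 4) * num_lim q a b"
    by (intro tendsto_mult tendsto_const qpochhammer_inf_LIMSEQ q4)
  have q2: "(\<lambda>m. q ^ (2 * m)) \<longlonglongrightarrow> 0"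
    unfolding power_mult using q
    by (intro LIMSEQ_power_zero) (auto simp: norm_power abs_square_less_1)
  have p1: "norm (q ^ (2 * m)) \<le> 1" for m
    using q by (auto simp: norm_power intro!: power_le_one)
  have "(\<lambda>m. num_lim q (a * q ^ (2 * m)) (b * q ^ (2 * m))) \<longlonglongrightarrow> num_lim q 0 0"
  proof (rule num_lim_continuous[OF q, where \<rho> = "norm (a * b)"])
    show "(\<lambda>m. a * q ^ (2 * m)) \<longlonglongrightarrow> 0" "(\<lambda>m. b * q ^ (2 * m)) \<longlonglongrightarrow> 0"
      using q2 by (auto intro: tendsto_mult_right_zero)
    show "norm (a * q ^ (2 * m)) \<le> norm a" "norm (b * q ^ (2 * m)) \<le> norm b" for m
      unfolding norm_mult using p1[of m] by (auto intro: mult_left_le)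
    have "norm (a * q ^ (2 * m) * (b * q ^ (2 * m))) = norm (a * b) * (norm (q ^ (2 * m)) * norm (q ^ (2 * m)))" for m
      by (simp only: norm_mult mult_ac)
    thus "norm (a * q ^ (2 * m) * (b * q ^ (2 * m))) \<le> norm (a * b)" for m
      using p1[of m] by (metis mult_left_le mult_le_one norm_ge_zero)
  qed (fact ab)
  hence "(\<lambda>m. ?P (a\<^sup>2 * q ^ 3) m * ?P (b\<^sup>2 * q ^ 3) m * num_lim q (a * q ^ (2 * m)) (b * q ^ (2 * m))) \<longlonglongrightarrow>
          qpochhammer_inf (a\<^sup>2 * q ^ 3) (q ^ 4) * qpochhammer_inf (b\<^sup>2 * q ^ 3) (q ^ 4) * num_lim q 0 0"
    by (intro tendsto_mult qpochhammer_inf_LIMSEQ q4)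
  thus "(\<lambda>m. ?P (- a * b) m * ?P (- a * b * q\<^sup>2) m * num_lim q a b) \<longlonglongrightarrow>
          qpochhammer_inf (a\<^sup>2 * q ^ 3) (q ^ 4) * qpochhammer_inf (b\<^sup>2 * q ^ 3) (q ^ 4) * num_lim q 0 0"
    unfolding num_lim_iterate[OF assms] .
qed

text \<open>
  One more shift reduces this to the product for the numerators at \<open>(aq, bq)\<close>; the factors
  \<open>1 + ab\<close>, \<open>1 - a^2 q\<close> and \<open>1 - b^2 q\<close> complete the infinite products by their first terms.
\<close>

lemma den_lim_product:
  assumes q: "norm q < 1" and ab: "norm (a * b) < 1"
  shows "qpochhammer_inf (- a * b) (q ^ 4) * qpochhammer_inf (- a * b * q\<^sup>2) (q ^ 4) * den_lim q a b
       = qpochhammer_inf (a\<^sup>2 * q) (q ^ 4) * qpochhammer_inf (b\<^sup>2 * q) (q ^ 4) * num_lim q 0 0"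
proof -
  have q4: "norm (q ^ 4) < 1"
    using q by (simp add: norm_power power_less_one_iff)
  have ab': "norm ((a * q) * (b * q)) < 1"
    using q by (intro norm_mult_shrink ab) auto
  note head = qpochhammer_inf_head[OF q4]
  have e: "- a * b * q ^ 4 = - (a * q) * (b * q) * q\<^sup>2" "- a * b * q\<^sup>2 = - (a * q) * (b * q)"
    "a\<^sup>2 * q * q ^ 4 = (a * q)\<^sup>2 * q ^ 3" "b\<^sup>2 * q * q ^ 4 = (b * q)\<^sup>2 * q ^ 3"
    by (simp_all add: power_mult_distrib eval_nat_numeral mult_ac)
  let ?S = "qpochhammer_inf (- (a * q) * (b * q) * q\<^sup>2) (q ^ 4) * qpochhammer_inf (- (a * q) * (b * q)) (q ^ 4)"
  have "qpochhammer_inf (- a * b) (q ^ 4) * qpochhammer_inf (- a * b * q\<^sup>2) (q ^ 4) * den_lim q a b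
          = ?S * ((1 + a * b) * den_lim q a b)"
    unfolding head[of "- a * b"] e by simp
  also have "\<dots> = (1 - a\<^sup>2 * q) * (1 - b\<^sup>2 * q) * (?S * num_lim q (a * q) (b * q))"
    unfolding den_lim_shift[OF assms] by simp
  also have "?S * num_lim q (a * q) (b * q) = qpochhammer_inf ((a * q)\<^sup>2 * q ^ 3) (q ^ 4)
               * qpochhammer_inf ((b * q)\<^sup>2 * q ^ 3) (q ^ 4) * num_lim q 0 0"
    using num_lim_product[OF q ab'] by (simp add: mult_ac)
  also have "(1 - a\<^sup>2 * q) * (1 - b\<^sup>2 * q) * \<dots>
      = qpochhammer_inf (a\<^sup>2 * q) (q ^ 4) * qpochhammer_inf (b\<^sup>2 * q) (q ^ 4) * num_lim q 0 0"
    unfolding head[of "a\<^sup>2 * q"] head[of "b\<^sup>2 * q"] e by simp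
  finally show ?thesis .
qed

text \<open>
  A vanishing factor on each side gives either \<open>c^2 q^(4i+3) = 1 = c^2 q^(4j+1)\<close> for \<open>c = a\<close> or
  \<open>c = b\<close>, which is impossible because the exponents differ modulo \<open>4\<close>, or, multiplying a condition
  on \<open>a\<close> by one on \<open>b\<close>, \<open>(ab)^2 q^m = 1\<close>, which is impossible because \<open>|ab| < 1\<close>.
\<close>

lemma products_not_both_zero:
  assumes q: "norm q < 1" and ab: "norm (a * b) < 1"
  shows "qpochhammer_inf (a\<^sup>2 * q ^ 3) (q ^ 4) * qpochhammer_inf (b\<^sup>2 * q ^ 3) (q ^ 4) \<noteq> 0 \<or>
         qpochhammer_inf (a\<^sup>2 * q) (q ^ 4) * qpochhammer_inf (b\<^sup>2 * q) (q ^ 4) \<noteq> 0"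
proof (rule ccontr)
  assume neg: "\<not> ?thesis"
  have q4: "norm (q ^ 4) < 1"
    using q by (simp add: norm_power power_less_one_iff)
  have same: False if i: "c\<^sup>2 * q ^ 3 * (q ^ 4) ^ i = 1" and j: "c\<^sup>2 * q * (q ^ 4) ^ j = 1" for c :: complex and i j
  proof -
    have c: "c \<noteq> 0" "q \<noteq> 0" using i j by auto
    have "c\<^sup>2 * q ^ (3 + 4 * i) = c\<^sup>2 * q ^ (1 + 4 * j)"
      using i j unfolding power_add power_mult by (simp add: mult.assoc)
    hence "norm q ^ (3 + 4 * i) = norm q ^ (1 + 4 * j)"
      using c by (metis mult_left_cancel norm_power power_not_zero)
    hence "3 + 4 * i = 1 + 4 * j"
      using q c by (subst (asm) power_inject_exp') auto
    thus False by presburger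
  qed
  have cross: False if "c * d = a * b" and i: "c\<^sup>2 * q ^ 3 * (q ^ 4) ^ i = 1" and j: "d\<^sup>2 * q * (q ^ 4) ^ j = 1"
    for c d :: complex and i j
  proof -
    have "(a * b)\<^sup>2 * q ^ (4 + 4 * i + 4 * j) = (c\<^sup>2 * q ^ 3 * (q ^ 4) ^ i) * (d\<^sup>2 * q * (q ^ 4) ^ j)"
      unfolding that(1)[symmetric] by (simp add: power_add power_mult power_mult_distrib eval_nat_numeral mult_ac)
    also have "\<dots> = 1" using i j by simp
    finally have "norm (a * b) ^ 2 * norm q ^ (4 + 4 * i + 4 * j) = 1"
      by (metis norm_mult norm_one norm_power)
    moreover have "norm (a * b) ^ 2 * norm q ^ (4 + 4 * i + 4 * j) \<le> norm (a * b) ^ 2 * 1"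
      using q by (intro mult_left_mono power_le_one) auto
    moreover have "norm (a * b) ^ 2 < 1"
      using ab by (simp add: abs_square_less_1)
    ultimately show False by linarith
  qed
  from neg show False
    unfolding mult_eq_0_iff de_Morgan_disj not_not qpochhammer_inf_eq_0_iff[OF q4]
    using same[of a] same[of b] cross[of a b] cross[of b a] by (metis mult.commute)
qed

theorem corollary3p2:
  fixes q a b :: complex and num den :: "nat \<Rightarrow> complex"
  assumes "norm q < 1" and "norm (a * b) < 1"
    and "\<And>n. n \<ge> 1 \<Longrightarrow> (a - b * q ^ (2 * n - 1)) * (b - a * q ^ (2 * n - 1)) \<noteq> 0"
    and "num 1 = 1" and "den 1 = 1 - a * b"
    and "\<And>n. n \<ge> 1 \<Longrightarrow> num (n + 1) = (a - b * q ^ (2 * n - 1)) * (b - a * q ^ (2 * n - 1))"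
    and "\<And>n. n \<ge> 1 \<Longrightarrow> den (n + 1) = (1 - a * b) * (1 + q ^ (2 * n))"
  shows "cf_converges_to num den
           (equotient
              (qpochhammer_inf (a\<^sup>2 * q ^ 3) (q ^ 4) * qpochhammer_inf (b\<^sup>2 * q ^ 3) (q ^ 4))
              (qpochhammer_inf (a\<^sup>2 * q) (q ^ 4) * qpochhammer_inf (b\<^sup>2 * q) (q ^ 4)))"
proof -
  note q = assms(1) and ab = assms(2)
  define N where "N = cf_solution q a b 0 1"
  define D where "D = cf_solution q a b 1 (1 - a * b)"
  \<comment> \<open>The first partial numerator \<open>1\<close> does not fit the pattern of the others, so one starting value
    is put in front of each sequence.\<close>
  define A where "A = case_nat 1 N"
  define B where "B = case_nat 0 D"
  have num: "num (Suc (Suc n)) = (a - b * q ^ (2 * n + 1)) * (b - a * q ^ (2 * n + 1))" for n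
    using assms(6)[of "Suc n"] by simp
  have den: "den (Suc (Suc n)) = (1 - a * b) * (1 + q ^ (2 * n + 2))" for n
    using assms(7)[of "Suc n"] by simp
  have nz: "num (Suc n) \<noteq> 0" for n
    using assms(3)[of n] assms(4) assms(6)[of n] by (cases n) auto
  have rec: "A (n + 2) = den (Suc n) * A (Suc n) + num (Suc n) * A n"
    "B (n + 2) = den (Suc n) * B (Suc n) + num (Suc n) * B n" for n
    using num den assms(4,5) by (cases n; simp add: A_def B_def N_def D_def)+
  have cf: "cf_comp num den n (Some 0) = equotient (N n) (D n)" for n
    using cf_comp_equotient(1)[of A den num B n 0] rec nz by (simp add: A_def B_def N_def D_def)
  define c where "c = num_lim q 0 0"
  define E where "E = qpochhammer_inf (- a * b) (q ^ 4) * qpochhammer_inf (- a * b * q\<^sup>2) (q ^ 4)"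
  define R where "R = qpochhammer_inf (a\<^sup>2 * q ^ 3) (q ^ 4) * qpochhammer_inf (b\<^sup>2 * q ^ 3) (q ^ 4)"
  define S where "S = qpochhammer_inf (a\<^sup>2 * q) (q ^ 4) * qpochhammer_inf (b\<^sup>2 * q) (q ^ 4)"
  have q4: "norm (q ^ 4) < 1" and q2: "norm (q\<^sup>2) < 1"
    using q by (simp_all add: norm_power power_less_one_iff)
  have "norm (- a * b * q\<^sup>2) < 1"
    using norm_mult_shrink[OF ab, of q q] q by (simp add: power2_eq_square norm_mult mult_ac)
  hence E: "E \<noteq> 0"
    using ab q4 by (simp add: E_def qpochhammer_inf_nonzero)
  have c: "c \<noteq> 0"
    using q q2 by (simp add: c_def num_lim_0_0 qpochhammer_inf_nonzero)
  have "E * num_lim q a b = R * c" "E * den_lim q a b = S * c"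
    using num_lim_product[OF q ab] den_lim_product[OF q ab]
    by (simp_all add: E_def R_def S_def c_def)
  hence lims: "num_lim q a b = c / E * R" "den_lim q a b = c / E * S"
    using E by (simp_all add: field_simps)
  have "R \<noteq> 0 \<or> S \<noteq> 0"
    using products_not_both_zero[OF q ab] by (simp add: R_def S_def)
  hence "num_lim q a b \<noteq> 0 \<or> den_lim q a b \<noteq> 0"
    using E c by (simp add: lims)
  hence "limitin ecomplex_top (\<lambda>n. equotient (N n) (D n))
           (equotient (num_lim q a b) (den_lim q a b)) sequentially"
    unfolding N_def D_def
    by (intro limitin_equotient num_lim_LIMSEQ den_lim_LIMSEQ q ab)
  also have "equotient (num_lim q a b) (den_lim q a b) = equotient R S"
    using E c by (simp add: lims equotient_def)
  finally show ?thesis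
    unfolding cf_converges_to_def cf R_def S_def .
qed

end
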